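(* Let $\mathcal H$ be a finite-dimensional complex Hilbert space, $I\subset\mathbb R$ an interval, and $t\mapsto\rho_t\in\mathcal D(\mathcal H)$, $t\in I$, a path of states that is differentiable almost everywhere with derivative $\dot\rho_t$. Let $\lambda_{\min}(t)$ be the spectral gap of $\rho_t$, i.e. its smallest nonzero eigenvalue. Assume that $\dot\rho_t$ is invertible for almost every $t$, that $t\mapsto\rho_t$, $t\mapsto\dot\rho_t$ and $t\mapsto\dot\rho_t^{-1}$ belong to $L^\infty(I,\mathbb B(\mathcal H))$, and that $\dot\rho_t\in T^+_{\rho_t}\mathcal D(\mathcal H)$ for almost every $t\in I$. If $\lambda_{\min}(t)^{-1}$ and $\sqrt{\lambda_{\min}(t)^{-1}}$ belong to $L^1(I)$, then there exists a Lindbladian lifting of the path: a family of Lindbladians $(L_t)_{t\in I}$ with $L_t(\rho_t)=\dot\rho_t$ for almost every $t\in I$ and such that $t\mapsto L_t$ is in $L^1$ on $I$ (with values in the space of linear maps on $\mathbb B(\mathcal H)$).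
   Context: $\mathbb B(\mathcal H)$ is the algebra of linear operators on $\mathcal H$; $\mathcal D(\mathcal H)=\{\rho\in\mathbb B(\mathcal H):\rho=\rho^*,\rho\ge 0,\mathrm{tr}\,\rho=1\}$. The tangent cone at $\rho$ is $T_\rho^+\mathcal D(\mathcal H)=\{\tfrac{d}{dt}|_{t=0}\rho_t: \rho_0=\rho,\ (\rho_t)\in C^2([0,\infty),\mathcal D(\mathcal H))\}$ (one-sided derivative at $0$). A Lindbladian is a linear map on $\mathbb B(\mathcal H)$ of the form $L(\rho)=-i[H,\rho]+\sum_{j=1}^n\big(L_j\rho L_j^*-\tfrac12(L_j^*L_j\rho+\rho L_j^*L_j)\big)$ with $H=H^*$ and $L_j\in\mathbb B(\mathcal H)$. *)

theory Defs
  imports "HOL-Analysis.Analysis"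
begin

text \<open>
  The Hilbert space is \<open>\<complex>\<^sup>n\<close> with its standard Hermitian inner product; the
  dimension \<open>n \<ge> 1\<close> is the cardinality of the index type, and operators are
  identified with their matrices in the standard basis. All norms on
  matrices and on superoperators are the library ones (Frobenius norm, respectively
  the operator norm it induces); as the spaces are finite-dimensional, membership in
  \<open>L\<^sup>1\<close> and \<open>L\<^sup>\<infinity>\<close> does not depend on this choice.
\<close>

type_synonym 'n op = "complex^'n^'n"

definition adjoint_op :: "'n::finite op \<Rightarrow> 'n op" where
  "adjoint_op A = map_matrix cnj (transpose A)"

definition cinner :: "complex^'n::finite \<Rightarrow> complex^'n \<Rightarrow> complex" where
  "cinner u v = (\<Sum>i\<in>UNIV. cnj (u $ i) * v $ i)"

definition pos_op :: "'n::finite op \<Rightarrow> bool" where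
  "pos_op A \<longleftrightarrow> (\<forall>v. cinner v (A *v v) \<in> \<real>\<^sub>\<ge>\<^sub>0)"

definition states :: "'n::finite op set" where
  "states = {\<rho>. \<rho> = adjoint_op \<rho> \<and> pos_op \<rho> \<and> trace \<rho> = 1}"

text \<open>
  \<open>C\<^sup>2\<close> on the closed half-line: the derivatives are taken within \<open>[0,\<infinity>)\<close>, hence are
  one-sided at \<open>0\<close>.
\<close>

definition tangent_cone :: "'n::finite op \<Rightarrow> 'n op set" where
  "tangent_cone \<rho> = {X. \<exists>\<gamma> \<gamma>' \<gamma>'' :: real \<Rightarrow> 'n op.
      (\<forall>t\<ge>0. \<gamma> t \<in> states) \<and>
      (\<forall>t\<ge>0. (\<gamma> has_vector_derivative \<gamma>' t) (at t within {0..})) \<and>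
      (\<forall>t\<ge>0. (\<gamma>' has_vector_derivative \<gamma>'' t) (at t within {0..})) \<and>
      continuous_on {0..} \<gamma>'' \<and>
      \<gamma> 0 = \<rho> \<and> \<gamma>' 0 = X}"

text \<open>
  The product with \<open>mat c\<close> is multiplication by the complex scalar \<open>c\<close>. The
  equation makes \<open>L\<close> complex linear.
\<close>

definition lindbladian :: "('n::finite op \<Rightarrow> 'n op) \<Rightarrow> bool" where
  "lindbladian L \<longleftrightarrow> (\<exists>(H :: 'n op) (m :: nat) (J :: nat \<Rightarrow> 'n op).
      H = adjoint_op H \<and>
      (\<forall>\<sigma>. L \<sigma> = mat (- \<i>) ** (H ** \<sigma> - \<sigma> ** H) +
        (\<Sum>j=1..m. J j ** \<sigma> ** adjoint_op (J j)
           - (1/2) *\<^sub>R (adjoint_op (J j) ** J j ** \<sigma> + \<sigma> ** adjoint_op (J j) ** J j))))"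

text \<open>
  Only real eigenvalues are considered, which are all of them for a Hermitian operator.
  For a state the set below is finite and nonempty, so that \<open>Min\<close> is a true minimum.
\<close>

definition spectral_gap :: "'n::finite op \<Rightarrow> real" where
  "spectral_gap A = Min {r. r \<noteq> 0 \<and> (\<exists>v. v \<noteq> 0 \<and> A *v v = complex_of_real r *s v)}"

definition in_Linf :: "real set \<Rightarrow> (real \<Rightarrow> 'b::euclidean_space) \<Rightarrow> bool" where
  "in_Linf I f \<longleftrightarrow> f \<in> borel_measurable (lebesgue_on I) \<and>
     (\<exists>C. AE t in lebesgue_on I. norm (f t) \<le> C)"

text \<open>
  Bochner integrability of functions with values in a space of bounded linear maps
  requires this class instance.
\<close>

instance blinfun :: (euclidean_space, euclidean_space) second_countable_topology
proof
  let ?e = "\<lambda>m::nat. 1 / Suc m"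
  have "\<exists>k. finite k \<and> cball (0 :: 'a \<Rightarrow>\<^sub>L 'b) (real n) \<subseteq> (\<Union>x\<in>k. ball x (?e m))" for n m :: nat
    using compact_cball[of "0 :: 'a \<Rightarrow>\<^sub>L 'b" "real n"] unfolding compact_eq_totally_bounded by auto
  then obtain k where fin: "\<And>n m. finite (k n m)"
    and cov: "\<And>n m. cball (0 :: 'a \<Rightarrow>\<^sub>L 'b) (real n) \<subseteq> (\<Union>x\<in>k n m. ball x (?e m))"
    by metis
  define B where "B = (\<Union>n. \<Union>m. (\<lambda>x. ball x (?e m)) ` k n m)"
  have "countable B"
    unfolding B_def by (simp add: countable_finite fin)
  moreover have "topological_basis B"
  proof (rule topological_basisI)
    show "open S" if "S \<in> B" for S
      using that by (auto simp: B_def)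
    fix O' :: "('a \<Rightarrow>\<^sub>L 'b) set" and x assume "open O'" "x \<in> O'"
    then obtain \<epsilon> where "\<epsilon> > 0" and e: "ball x \<epsilon> \<subseteq> O'"
      by (meson open_contains_ball)
    obtain m :: nat where m: "?e m < \<epsilon> / 2"
      using \<open>\<epsilon> > 0\<close> nat_approx_posE[of "\<epsilon> / 2"] by auto
    obtain n :: nat where "norm x \<le> real n"
      using real_arch_simple by blast
    with cov[of n m] obtain y where y: "y \<in> k n m" "x \<in> ball y (?e m)"
      by auto
    have "ball y (?e m) \<subseteq> ball x \<epsilon>"
    proof
      fix z assume "z \<in> ball y (?e m)"
      with y m show "z \<in> ball x \<epsilon>"
        using dist_triangle[of x z y] by (auto simp: dist_commute)
    qed
    with e y show "\<exists>B'\<in>B. x \<in> B' \<and> B' \<subseteq> O'"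
      by (intro bexI[of _ "ball y (?e m)"]) (auto simp: B_def)
  qed
  ultimately show "\<exists>B :: ('a \<Rightarrow>\<^sub>L 'b) set set. countable B \<and> open = generate_topology B"
    using topological_basis_imp_subbasis by blast
qed

end

theory Submission
  imports Defs
begin

text \<open>
  At an interior point of \<open>I\<close> where \<open>\<rho>\<close> is differentiable, \<open>\<langle>v, \<rho>\<^sub>s v\<rangle>\<close> is minimal at \<open>s = t\<close>
  for every \<open>v\<close> in the kernel of \<open>\<rho>\<^sub>t\<close>; hence \<open>X = \<rho>'\<^sub>t\<close> satisfies \<open>P X P = 0\<close> for the kernel
  projection \<open>P\<close>. Let \<open>\<lambda>\<close> be the spectral gap and \<open>S\<close> the pseudo-inverse of \<open>\<rho>\<^sub>t\<close>, \<open>Q = 1 - P\<close>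
  and \<open>K = P X S\<close>. The Hamiltonian \<open>H = i (K - K\<^sup>*)\<close> produces the off-diagonal part
  \<open>P X Q + Q X P\<close> of \<open>X\<close>. The rest \<open>Q X Q\<close> is traceless and supported where \<open>\<rho>\<^sub>t \<ge> \<lambda>\<close>, so
  \<open>Z = c \<rho>\<^sub>t + Q X Q\<close> is positive for \<open>c = M / \<lambda>\<close> with \<open>M\<close> a bound on \<open>X\<close>, and the Lindbladian
  \<open>\<sigma> \<mapsto> tr \<sigma> Z - tr Z \<sigma>\<close> maps \<open>\<rho>\<^sub>t\<close> to \<open>Q X Q\<close>. Both parts have norm of order \<open>1 / \<lambda>\<close>. They
  depend measurably on \<open>t\<close> because \<open>P\<close> and \<open>S\<close> are limits of polynomials in \<open>\<rho>\<^sub>t\<close>, obtained by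
  iterating \<open>1 - a \<rho>\<^sub>t\<close> for small \<open>a > 0\<close>.
\<close>

subsection \<open>Operators as real-linear maps\<close>

lemma bounded_bilinear_matrix_mult:
  "bounded_bilinear ((**) :: 'n::finite op \<Rightarrow> 'n op \<Rightarrow> 'n op)"
  unfolding bilinear_conv_bounded_bilinear[symmetric] bilinear_def
  by (auto intro!: linearI simp: matrix_add_ldistrib matrix_matrix_mult_def vec_eq_iff
      sum.distrib algebra_simps scaleR_sum_right)

interpretation op_mult: bounded_bilinear "(**) :: 'n::finite op \<Rightarrow> 'n op \<Rightarrow> 'n op"
  by (rule bounded_bilinear_matrix_mult)

lemma bounded_bilinear_matrix_vector:
  "bounded_bilinear ((*v) :: 'n::finite op \<Rightarrow> complex^'n \<Rightarrow> complex^'n)"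
  unfolding bilinear_conv_bounded_bilinear[symmetric] bilinear_def
  by (auto intro!: linearI simp: matrix_vector_mult_def vec_eq_iff
      sum.distrib algebra_simps scaleR_sum_right)

interpretation op_vec: bounded_bilinear "(*v) :: 'n::finite op \<Rightarrow> complex^'n \<Rightarrow> complex^'n"
  by (rule bounded_bilinear_matrix_vector)

lemma bounded_linear_adjoint_op: "bounded_linear (adjoint_op :: 'n::finite op \<Rightarrow> 'n op)"
  unfolding linear_conv_bounded_linear[symmetric]
  by (auto intro!: linearI simp: adjoint_op_def map_matrix_def transpose_def vec_eq_iff
      )

lemmas adjoint_op_add = linear_add[OF bounded_linear.linear[OF bounded_linear_adjoint_op]]
  and adjoint_op_diff = linear_diff[OF bounded_linear.linear[OF bounded_linear_adjoint_op]]
  and adjoint_op_scaleR = linear_cmul[OF bounded_linear.linear[OF bounded_linear_adjoint_op]]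
  and adjoint_op_0 = linear_0[OF bounded_linear.linear[OF bounded_linear_adjoint_op]]

lemma adjoint_op_nth [simp]: "adjoint_op A $ i $ j = cnj (A $ j $ i)"
  by (simp add: adjoint_op_def map_matrix_def transpose_def)

lemma adjoint_op_adjoint_op [simp]: "adjoint_op (adjoint_op A) = A"
  by (simp add: vec_eq_iff)

lemma adjoint_op_mat: "adjoint_op (mat c) = mat (cnj c)"
  by (simp add: vec_eq_iff mat_def)

lemma adjoint_op_mult: "adjoint_op (A ** B) = adjoint_op B ** adjoint_op A"
  by (simp add: vec_eq_iff matrix_matrix_mult_def mult.commute)

lemma inner_eq_Re_cinner: "u \<bullet> v = Re (cinner u v)" for u v :: "complex^'n::finite"
  by (simp add: inner_vec_def cinner_def inner_complex_def)

text \<open>The real inner product is the real part of the Hermitian one, so adjoints carry over and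
  later estimates can use the real form.\<close>

lemma inner_adjoint_op: "u \<bullet> (A *v w) = (adjoint_op A *v u) \<bullet> w" for u w :: "complex^'n::finite"
proof -
  have "cinner u (A *v w) = cinner (adjoint_op A *v u) w"
    unfolding cinner_def matrix_vector_mult_def
    by (simp add: sum_distrib_left sum_distrib_right, subst sum.swap)
      (simp add: algebra_simps)
  then show ?thesis by (simp add: inner_eq_Re_cinner)
qed

lemma mat_mult_commute: "mat c ** A = A ** mat c" for A :: "'n::finite op"
  by (simp add: vec_eq_iff matrix_matrix_mult_def mat_def if_distrib if_distribR cong: if_cong)

lemma mat_mult_nth: "(mat c ** A) $ i $ j = c * A $ i $ j" for A :: "'n::finite op"
  by (simp add: matrix_matrix_mult_def mat_def if_distrib if_distribR cong: if_cong)

lemma trace_scaleR: "trace (r *\<^sub>R A) = complex_of_real r * trace A" for A :: "'n::finite op"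
  by (simp add: trace_def sum_distrib_left scaleR_conv_of_real[where 'a=complex])

text \<open>Entries are coordinates of images of basis vectors. This turns bounds on vectors into
  Frobenius bounds, at the price of the squared dimension.\<close>

lemma norm_op_le_of_bound:
  fixes A :: "'n::finite op"
  assumes "\<And>v. norm (A *v v) \<le> b * norm v"
  shows "norm A \<le> real CARD('n) * real CARD('n) * b"
proof -
  have entry: "norm (A $ i $ j) \<le> b" for i j
  proof -
    have "A $ i $ j = (A *v axis j 1) $ i"
      by (simp add: matrix_vector_mult_def axis_def if_distrib cong: if_cong)
    then show ?thesis
      using assms[of "axis j 1"] Finite_Cartesian_Product.norm_nth_le[of "A *v axis j 1" i]
      by simp
  qed
  have "norm (A $ i) \<le> real CARD('n) * b" for i
  proof -
    have "norm (A $ i) \<le> (\<Sum>j\<in>UNIV. norm (A $ i $ j))"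
      unfolding norm_vec_def by (rule L2_set_le_sum) simp
    also have "\<dots> \<le> (\<Sum>j\<in>(UNIV::'n set). b)"
      by (intro sum_mono entry)
    finally show ?thesis by simp
  qed
  then have "(\<Sum>i\<in>UNIV. norm (A $ i)) \<le> (\<Sum>i\<in>(UNIV::'n set). real CARD('n) * b)"
    by (intro sum_mono)
  moreover have "norm A \<le> (\<Sum>i\<in>UNIV. norm (A $ i))"
    unfolding norm_vec_def[of A] by (rule L2_set_le_sum) simp
  ultimately show ?thesis by simp
qed

text \<open>Minimality of the form at \<open>w\<close> makes its gradient \<open>2 A w\<close> vanish.\<close>

lemma op_vec_eq_0_of_nonneg:
  fixes A :: "'n::finite op"
  assumes herm: "adjoint_op A = A"
    and S: "subspace S" "w \<in> S" "A *v w \<in> S"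
    and nonneg: "\<And>u. u \<in> S \<Longrightarrow> 0 \<le> u \<bullet> (A *v u)"
    and zero: "w \<bullet> (A *v w) = 0"
  shows "A *v w = 0"
proof (rule ccontr)
  assume nz: "A *v w \<noteq> 0"
  define g where "g = A *v w"
  define b where "b = g \<bullet> (A *v g)"
  have gg: "0 < g \<bullet> g" using nz by (simp add: g_def)
  have b0: "0 \<le> b" unfolding b_def by (rule nonneg) (use S in \<open>simp add: g_def\<close>)
  \<comment> \<open>A step of length \<open>s\<close> against \<open>g\<close> changes the form by
    \<open>s * (s * b - 2 * (g \<bullet> g))\<close>. This \<open>s\<close> keeps
    \<open>s * b\<close> at most \<open>g \<bullet> g\<close>; the \<open>+ 1\<close> avoids
    division by zero.\<close>
  define s where "s = (g \<bullet> g) / (b + 1)"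
  have s0: "0 < s" using gg b0 by (simp add: s_def)
  have "w - s *\<^sub>R g \<in> S"
    using S by (simp add: g_def subspace_diff subspace_scale)
  from nonneg[OF this] have "0 \<le> - 2 * s * (g \<bullet> g) + s * s * b"
    using zero inner_adjoint_op[of w A g]
    by (simp add: herm b_def op_vec.diff_right op_vec.scaleR_right inner_diff_left inner_diff_right
        g_def[symmetric] inner_commute algebra_simps)
  then have "0 \<le> s * (s * b - 2 * (g \<bullet> g))" by (simp add: algebra_simps)
  then have "2 * (g \<bullet> g) \<le> s * b" using s0 by (simp add: zero_le_mult_iff)
  also have "\<dots> \<le> g \<bullet> g" using b0 gg by (simp add: s_def field_simps)
  finally show False using gg by simp
qed

subsection \<open>Support projection and pseudo-inverse\<close>

text \<open>A Hermitian operator is injective on its range, hence onto it by dimension, so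
  \<open>A ** A ** W = A\<close> can be solved column by column. Then \<open>A ** W\<close> is the
  range projection.\<close>

lemma hermitian_pseudo_inverse_exists:
  fixes A :: "'n::finite op"
  assumes herm: "adjoint_op A = A"
  shows "\<exists>R. adjoint_op R = R \<and> adjoint_op (A ** R) = A ** R \<and> A ** R ** A = A \<and> R ** A ** R = R"
proof -
  let ?V = "range ((*v) A)"
  have lin: "linear ((*v) A)" by (simp add: bounded_linear.linear op_vec.bounded_linear_right)
  have sub: "subspace ?V" using lin linear_subspace_image[of "(*v) A" UNIV] by simp
  have inj: "inj_on ((*v) A) ?V"
  proof (rule inj_onI)
    fix x y assume x: "x \<in> ?V" and y: "y \<in> ?V" and eq: "A *v x = A *v y"
    have "x - y \<in> ?V" using x y sub by (simp add: subspace_diff)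
    then obtain z where z: "x - y = A *v z" by auto
    have "(x - y) \<bullet> (x - y) = (A *v (x - y)) \<bullet> z"
      using inner_adjoint_op[of "x - y" A z] herm by (simp add: z)
    then show "x = y" by (simp add: op_vec.diff_right eq)
  qed
  have "(*v) A ` ?V = ?V"
  proof (rule subspace_dim_equal)
    show "subspace ((*v) A ` ?V)" using lin sub by (rule linear_subspace_image)
    show "(*v) A ` ?V \<subseteq> ?V" by auto
    show "dim ?V \<le> dim ((*v) A ` ?V)"
      using inj by (subst dim_image_eq[OF lin]) (simp_all add: span_eq_iff[THEN iffD2, OF sub])
  qed (rule sub)
  then have "\<forall>j. \<exists>w. A *v (A *v w) = A *v axis j 1" by (metis imageE rangeI)
  then obtain w where w: "\<And>j. A *v (A *v w j) = A *v axis j 1" by metis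
  define W where "W = (\<chi> i j. w j $ i)"
  have nth: "(B ** C) $ i $ j = (B *v column j C) $ i" "B $ i $ j = (B *v axis j 1) $ i"
    for B C :: "'n op" and i j
    by (simp_all add: matrix_matrix_mult_def matrix_vector_mult_def column_def axis_def
        if_distrib cong: if_cong)
  have "A ** (A ** W) = A"
  proof -
    have "column j (A ** W) = A *v w j" for j
      by (simp add: vec_eq_iff matrix_matrix_mult_def matrix_vector_mult_def column_def W_def)
    then have "(A ** (A ** W)) $ i $ j = A $ i $ j" for i j
      by (subst nth(1)) (simp add: w, simp add: nth(2)[symmetric])
    then show ?thesis by (simp add: vec_eq_iff)
  qed
  then have AAW: "A ** A ** W = A" by (simp add: matrix_mul_assoc)
  define Q where "Q = A ** W"
  have adjQ: "adjoint_op Q = adjoint_op W ** A" by (simp add: Q_def adjoint_op_mult herm)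
  have AQ: "A ** Q = A" by (simp add: Q_def AAW matrix_mul_assoc)
  have QA: "adjoint_op Q ** A = A" using arg_cong[OF AQ, of adjoint_op] by (simp add: adjoint_op_mult herm)
  \<comment> \<open>Multiplying \<open>adjoint_op Q ** A = A\<close> by \<open>W\<close> on the
    right gives this identity, which makes \<open>Q\<close> Hermitian and then idempotent.\<close>
  have "Q = adjoint_op Q ** Q"
    by (metis QA Q_def matrix_mul_assoc)
  then have Qh: "adjoint_op Q = Q"
    by (metis adjoint_op_adjoint_op adjoint_op_mult)
  with \<open>Q = adjoint_op Q ** Q\<close> have QQ: "Q ** Q = Q" by simp
  \<comment> \<open>Expanded, this is \<open>adjoint_op W ** A ** W\<close>, which is manifestly
    Hermitian.\<close>
  define R where "R = adjoint_op W ** Q"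
  have R2: "R = Q ** W" by (metis Qh Q_def R_def adjQ matrix_mul_assoc)
  have "adjoint_op R = R" by (metis Qh R2 R_def adjoint_op_adjoint_op adjoint_op_mult)
  moreover have "A ** R = Q" by (metis AQ Q_def R2 matrix_mul_assoc)
  moreover have "Q ** R = R" by (metis QQ R2 matrix_mul_assoc)
  moreover have "R ** A = Q" by (metis Qh adjoint_op_mult calculation(1,2) herm)
  ultimately show ?thesis using Qh QA by (intro exI[of _ R]) simp
qed

text \<open>Hermiticity is demanded separately because the real inner product sees only the real
  part of the form.\<close>

definition psd :: "'n::finite op \<Rightarrow> bool" where
  "psd A \<longleftrightarrow> adjoint_op A = A \<and> (\<forall>v. 0 \<le> v \<bullet> (A *v v))"

text \<open>For Hermitian \<open>A\<close> this is the Moore-Penrose inverse: as \<open>R\<close> is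
  Hermitian too, the adjoint of \<open>A ** R\<close> is \<open>R ** A\<close>, which yields the
  fourth Penrose condition.\<close>

definition pseudo_inverse :: "'n::finite op \<Rightarrow> 'n op" where
  "pseudo_inverse A =
    (SOME R. adjoint_op R = R \<and> adjoint_op (A ** R) = A ** R \<and> A ** R ** A = A \<and> R ** A ** R = R)"

text \<open>For Hermitian \<open>A\<close>, the orthogonal projection onto the range.\<close>

definition support_proj :: "'n::finite op \<Rightarrow> 'n op" where
  "support_proj A = A ** pseudo_inverse A"

lemma states_psd: "\<rho> \<in> states \<Longrightarrow> psd \<rho>"
  by (auto simp: states_def pos_op_def psd_def inner_eq_Re_cinner complex_nonneg_Reals_iff)

lemma
  fixes A :: "'n::finite op"
  assumes "adjoint_op A = A"
  shows adjoint_pseudo_inverse: "adjoint_op (pseudo_inverse A) = pseudo_inverse A"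
    and adjoint_support_proj: "adjoint_op (support_proj A) = support_proj A"
    and support_proj_mult: "support_proj A ** A = A"
    and mult_support_proj: "A ** support_proj A = A"
    and pseudo_inverse_mult: "pseudo_inverse A ** A = support_proj A"
    and support_proj_pseudo_inverse: "support_proj A ** pseudo_inverse A = pseudo_inverse A"
    and support_proj_idem: "support_proj A ** support_proj A = support_proj A"
proof -
  let ?R = "pseudo_inverse A"
  have *: "adjoint_op ?R = ?R \<and> adjoint_op (A ** ?R) = A ** ?R \<and> A ** ?R ** A = A \<and> ?R ** A ** ?R = ?R"
    unfolding pseudo_inverse_def by (rule someI_ex) (rule hermitian_pseudo_inverse_exists[OF assms])
  then show 1: "adjoint_op ?R = ?R" and 2: "adjoint_op (support_proj A) = support_proj A"
    and 3: "support_proj A ** A = A"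
    by (auto simp: support_proj_def)
  show 4: "?R ** A = support_proj A"
    using 1 2 assms by (metis adjoint_op_mult support_proj_def)
  show "A ** support_proj A = A"
    using 3 4 by (metis matrix_mul_assoc support_proj_def)
  show "support_proj A ** ?R = ?R"
    using * 4 by simp
  show "support_proj A ** support_proj A = support_proj A"
    using 3 by (metis matrix_mul_assoc support_proj_def)
qed

section \<open>Eigenvalues and the spectral gap\<close>

text \<open>Eigenvectors for distinct eigenvalues are orthogonal, hence independent. Finiteness
  makes the \<open>Min\<close> in \<open>spectral_gap\<close> a true minimum.\<close>

lemma finite_eigenvalues:
  fixes A :: "'n::finite op"
  assumes herm: "adjoint_op A = A"
  shows "finite {r::real. \<exists>v. v \<noteq> 0 \<and> A *v v = r *\<^sub>R v}" (is "finite ?E")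
proof -
  have "\<forall>r\<in>?E. \<exists>v. v \<noteq> 0 \<and> A *v v = r *\<^sub>R v" by simp
  then obtain f where f: "\<And>r. r \<in> ?E \<Longrightarrow> f r \<noteq> 0 \<and> A *v f r = r *\<^sub>R f r"
    unfolding bchoice_iff by blast
  have orth: "f r \<bullet> f s = 0" if "r \<in> ?E" "s \<in> ?E" "r \<noteq> s" for r s
  proof -
    have "s * (f r \<bullet> f s) = r * (f r \<bullet> f s)"
      using inner_adjoint_op[of "f r" A "f s"] f that by (simp add: herm)
    then show ?thesis using that by simp
  qed
  have "inj_on f ?E"
  proof (rule inj_onI, rule ccontr)
    fix r s assume "r \<in> ?E" "s \<in> ?E" "f r = f s" "r \<noteq> s"
    then show False using orth[of r s] f[of r] by simp
  qed
  moreover have "independent (f ` ?E)"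
    by (rule pairwise_orthogonal_independent)
      (use orth f in \<open>force simp: pairwise_def orthogonal_def\<close>)+
  ultimately show ?thesis
    using independent_imp_finite finite_imageD by blast
qed

text \<open>
  The Rayleigh quotient on the unit sphere of the support attains its minimum at an
  eigenvector.
\<close>

lemma psd_smallest_eigenvalue:
  fixes A :: "'n::finite op"
  assumes psd: "psd A" and nz: "A \<noteq> 0"
  obtains r v where "r \<noteq> 0" "v \<noteq> 0" "A *v v = r *\<^sub>R v"
    "\<And>u. support_proj A *v u = u \<Longrightarrow> r * (u \<bullet> u) \<le> u \<bullet> (A *v u)"
proof -
  let ?Q = "support_proj A"
  have herm: "adjoint_op A = A" using psd by (simp add: psd_def)
  define V where "V = {u. ?Q *v u = u}"
  have subV: "subspace V"
    by (auto simp: V_def subspace_def op_vec.add_right op_vec.scaleR_right)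
  have AV: "A *v u \<in> V" for u
    using support_proj_mult[OF herm] by (simp add: V_def matrix_vector_mul_assoc)
  obtain z where z: "A *v z \<noteq> 0"
    using nz by (metis matrix_eq matrix_vector_mult_0)
  define K where "K = V \<inter> sphere 0 1"
  have "compact K"
    unfolding K_def using closed_subspace[OF subV] by (intro closed_Int_compact) auto
  moreover have "(1 / norm (A *v z)) *\<^sub>R (A *v z) \<in> K"
    using z AV subV by (simp add: K_def subspace_scale)
  then have "K \<noteq> {}" by blast
  moreover have "continuous_on K (\<lambda>u. u \<bullet> (A *v u))"
    by (intro continuous_intros op_vec.continuous_on)
  ultimately obtain v where v: "v \<in> K" and min: "\<And>u. u \<in> K \<Longrightarrow> v \<bullet> (A *v v) \<le> u \<bullet> (A *v u)"
    using continuous_attains_inf by metis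
  define r where "r = v \<bullet> (A *v v)"
  have vV: "v \<in> V" and v1: "norm v = 1" using v by (auto simp: K_def)
  have ray: "r * (u \<bullet> u) \<le> u \<bullet> (A *v u)" if "u \<in> V" for u
  proof (cases "u = 0")
    case False
    let ?u = "(1 / norm u) *\<^sub>R u"
    have "?u \<in> K" using that False subV by (simp add: K_def subspace_scale)
    then have "r \<le> ?u \<bullet> (A *v ?u)" unfolding r_def by (rule min)
    also have "\<dots> = (u \<bullet> (A *v u)) / (norm u)\<^sup>2"
      by (simp add: op_vec.scaleR_right power2_eq_square)
    finally show ?thesis
      using False by (simp add: field_simps dot_square_norm)
  qed simp
  \<comment> \<open>The form of \<open>?B\<close> is nonnegative on the support and vanishes at
    \<open>v\<close>, so minimality puts \<open>v\<close> in the kernel of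
    \<open>?B\<close>.\<close>
  let ?B = "A - r *\<^sub>R mat 1"
  have B: "?B *v u = A *v u - r *\<^sub>R u" for u
    by (simp add: op_vec.diff_left op_vec.scaleR_left)
  have "?B *v v = 0"
  proof (rule op_vec_eq_0_of_nonneg[OF _ subV vV])
    show "adjoint_op ?B = ?B"
      by (simp add: adjoint_op_diff adjoint_op_scaleR adjoint_op_mat herm)
    show "?B *v v \<in> V" using AV vV subV by (simp add: B subspace_diff subspace_scale)
    show "0 \<le> u \<bullet> (?B *v u)" if "u \<in> V" for u
      using ray[OF that] by (simp add: B inner_diff_right)
    show "v \<bullet> (?B *v v) = 0"
      using v1 r_def[symmetric] by (simp add: B inner_diff_right dot_square_norm)
  qed
  then have eig: "A *v v = r *\<^sub>R v" by (simp add: B)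
  \<comment> \<open>The unit vector \<open>v\<close> lies in the support, where the pseudo-inverse
    undoes \<open>A\<close>, so \<open>A\<close> cannot annihilate it.\<close>
  have "r \<noteq> 0"
  proof
    assume "r = 0"
    then have "pseudo_inverse A *v (A *v v) = 0" by (simp add: eig)
    then show False
      using vV v1 pseudo_inverse_mult[OF herm] by (simp add: matrix_vector_mul_assoc V_def)
  qed
  with eig v1 ray show ?thesis
    by (intro that[of r v]) (auto simp: V_def)
qed

text \<open>The Rayleigh minimum is itself a nonzero eigenvalue, so the gap lies below it and
  inherits its lower bound for the form.\<close>

lemma
  fixes A :: "'n::finite op"
  assumes psd: "psd A" and nz: "A \<noteq> 0"
  shows spectral_gap_pos: "0 < spectral_gap A"
    and spectral_gap_eigenvector: "\<exists>v. v \<noteq> 0 \<and> A *v v = spectral_gap A *\<^sub>R v"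
    and spectral_gap_le: "support_proj A *v u = u \<Longrightarrow> spectral_gap A * (u \<bullet> u) \<le> u \<bullet> (A *v u)"
proof -
  have herm: "adjoint_op A = A" using psd by (simp add: psd_def)
  define E where "E = {r. r \<noteq> 0 \<and> (\<exists>v. v \<noteq> 0 \<and> A *v v = r *\<^sub>R v)}"
  have scal: "complex_of_real r *s v = r *\<^sub>R v" for r and v :: "complex^'n"
    by (simp add: vec_eq_iff scaleR_conv_of_real[where 'a=complex])
  have gap: "spectral_gap A = Min E"
    by (simp add: spectral_gap_def E_def scal)
  have fin: "finite E"
    unfolding E_def by (rule finite_subset[OF _ finite_eigenvalues[OF herm]]) auto
  obtain r v where r: "r \<noteq> 0" "v \<noteq> 0" "A *v v = r *\<^sub>R v"
    and ray: "\<And>u. support_proj A *v u = u \<Longrightarrow> r * (u \<bullet> u) \<le> u \<bullet> (A *v u)"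
    using psd_smallest_eigenvalue[OF psd nz] by metis
  have "r \<in> E" using r by (auto simp: E_def)
  then have in_E: "Min E \<in> E" and le: "Min E \<le> r" using fin by (auto intro: Min_in)
  then show ex: "\<exists>v. v \<noteq> 0 \<and> A *v v = spectral_gap A *\<^sub>R v"
    by (auto simp: gap E_def)
  then obtain w where w: "w \<noteq> 0" "A *v w = spectral_gap A *\<^sub>R w" by blast
  have "0 \<le> w \<bullet> (A *v w)" using psd by (simp add: psd_def)
  then have "0 \<le> spectral_gap A * (w \<bullet> w)" using w by simp
  then have "0 \<le> spectral_gap A" using w inner_gt_zero_iff[of w]
    by (simp add: zero_le_mult_iff del: inner_gt_zero_iff)
  moreover have "spectral_gap A \<noteq> 0" using in_E by (simp add: gap E_def)
  ultimately show "0 < spectral_gap A" by simp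
  assume "support_proj A *v u = u"
  from ray[OF this] show "spectral_gap A * (u \<bullet> u) \<le> u \<bullet> (A *v u)"
    using mult_right_mono[OF le, of "u \<bullet> u"] by (simp add: gap)
qed

text \<open>The image \<open>u\<close> of \<open>v\<close> lies in the support, so the gap times the
  square of \<open>norm u\<close> is at most \<open>u \<bullet> (A *v u) = u \<bullet> v\<close>;
  Cauchy-Schwarz finishes.\<close>

lemma norm_pseudo_inverse_vec:
  fixes A :: "'n::finite op"
  assumes psd: "psd A" and nz: "A \<noteq> 0"
  shows "norm (pseudo_inverse A *v v) \<le> inverse (spectral_gap A) * norm v"
proof -
  let ?u = "pseudo_inverse A *v v" and ?Q = "support_proj A"
  have herm: "adjoint_op A = A" using psd by (simp add: psd_def)
  have Qu: "?Q *v ?u = ?u"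
    by (simp add: matrix_vector_mul_assoc support_proj_pseudo_inverse[OF herm])
  have "spectral_gap A * (norm ?u * norm ?u) \<le> ?u \<bullet> (?Q *v v)"
    using spectral_gap_le[OF psd nz Qu]
    by (simp add: matrix_vector_mul_assoc support_proj_def dot_square_norm power2_eq_square)
  also have "\<dots> = ?u \<bullet> v"
    by (subst inner_adjoint_op) (simp add: adjoint_support_proj[OF herm] Qu)
  also have "\<dots> \<le> norm ?u * norm v" by (rule norm_cauchy_schwarz)
  finally have "norm ?u * (spectral_gap A * norm ?u) \<le> norm ?u * norm v" by (simp add: ac_simps)
  then have "spectral_gap A * norm ?u \<le> norm v"
    by (cases "norm ?u = 0") simp_all
  then show ?thesis
    using spectral_gap_pos[OF psd nz] by (simp add: field_simps)
qed

text \<open>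
  On the support, \<open>1 - a A\<close> is a strict contraction; on the kernel it is the identity.
\<close>

lemma gradient_iteration_tendsto:
  fixes A X :: "'n::finite op"
  assumes psd: "psd A" and nz: "A \<noteq> 0"
    and b: "\<And>u. norm (A *v u) \<le> b * norm u" and a: "0 < a" "a * b\<^sup>2 \<le> spectral_gap A"
  shows "(\<lambda>k. ((\<lambda>Y. Y - a *\<^sub>R (A ** Y)) ^^ k) X) \<longlonglongrightarrow> X - support_proj A ** X"
proof -
  let ?Q = "support_proj A" and ?f = "\<lambda>Y. Y - a *\<^sub>R (A ** Y)"
  have herm: "adjoint_op A = A" using psd by (simp add: psd_def)
  \<comment> \<open>In the expansion of the squared norm of \<open>u - a *\<^sub>R (A *v u)\<close>,
    the condition on \<open>a\<close> lets half of the linear term absorb the quadratic one, leaving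
    the factor \<open>1 - a * spectral_gap A\<close>. The \<open>max\<close> ensures that
    \<open>q\<close> is nonnegative.\<close>
  define q where "q = sqrt (max 0 (1 - a * spectral_gap A))"
  have "0 < a * spectral_gap A" using a spectral_gap_pos[OF psd nz] by simp
  then have q: "0 \<le> q" "q < 1" by (auto simp: q_def max_def)
  have contr: "norm (u - a *\<^sub>R (A *v u)) \<le> q * norm u" if "?Q *v u = u" for u
  proof (rule power2_le_imp_le)
    have "(norm (A *v u))\<^sup>2 \<le> b\<^sup>2 * (norm u)\<^sup>2"
      using power_mono[OF b[of u], of 2] by (simp add: power_mult_distrib)
    then have "a\<^sup>2 * (norm (A *v u))\<^sup>2 \<le> a\<^sup>2 * (b\<^sup>2 * (norm u)\<^sup>2)"
      by (rule mult_left_mono) simp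
    also have "\<dots> = (a * (norm u)\<^sup>2) * (a * b\<^sup>2)" by (simp add: power2_eq_square)
    also have "\<dots> \<le> (a * (norm u)\<^sup>2) * spectral_gap A"
      using a by (intro mult_left_mono) auto
    finally have 1: "a\<^sup>2 * (norm (A *v u))\<^sup>2 \<le> a * (spectral_gap A * (norm u)\<^sup>2)"
      by (simp add: ac_simps)
    have 2: "a * (spectral_gap A * (norm u)\<^sup>2) \<le> a * (u \<bullet> (A *v u))"
      using spectral_gap_le[OF psd nz that] a by (simp add: dot_square_norm)
    have "(norm (u - a *\<^sub>R (A *v u)))\<^sup>2
        = (norm u)\<^sup>2 - 2 * (a * (u \<bullet> (A *v u))) + a\<^sup>2 * (norm (A *v u))\<^sup>2"
      unfolding dot_square_norm[symmetric]
      by (simp add: inner_diff_left inner_diff_right inner_commute power2_eq_square algebra_simps)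
    also have "\<dots> \<le> (1 - a * spectral_gap A) * (norm u)\<^sup>2"
      using 1 2 by (simp add: algebra_simps)
    also have "\<dots> \<le> q\<^sup>2 * (norm u)\<^sup>2"
      by (rule mult_right_mono) (auto simp: q_def)
    finally show "(norm (u - a *\<^sub>R (A *v u)))\<^sup>2 \<le> (q * norm u)\<^sup>2"
      by (simp add: power_mult_distrib)
  qed (use q in simp)
  \<comment> \<open>The kernel part \<open>X - Y\<close> is fixed by the iteration, while the
    support part \<open>Y\<close> is contracted to zero.\<close>
  define Y where "Y = ?Q ** X"
  have split: "(?f ^^ k) X = X - Y + (?f ^^ k) Y" for k
  proof (induction k)
    case (Suc k)
    have "A ** (X - Y) = 0"
      unfolding Y_def op_mult.diff_right matrix_mul_assoc mult_support_proj[OF herm] by simp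
    then show ?case by (simp add: Suc op_mult.add_right)
  qed simp
  have inQ: "?Q ** (?f ^^ k) Y = (?f ^^ k) Y" for k
    by (induction k)
      (simp_all add: Y_def matrix_mul_assoc support_proj_idem[OF herm] support_proj_mult[OF herm]
        op_mult.diff_right op_mult.scaleR_right)
  have bound: "norm ((?f ^^ k) Y *v v) \<le> q ^ k * norm (Y *v v)" for k v
  proof (induction k)
    case (Suc k)
    have "(?f ^^ Suc k) Y *v v = (?f ^^ k) Y *v v - a *\<^sub>R (A *v ((?f ^^ k) Y *v v))"
      by (simp add: op_vec.diff_left op_vec.scaleR_left matrix_vector_mul_assoc)
    then have "norm ((?f ^^ Suc k) Y *v v) \<le> q * norm ((?f ^^ k) Y *v v)"
      using contr[of "(?f ^^ k) Y *v v"] by (simp add: matrix_vector_mul_assoc inQ)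
    also have "\<dots> \<le> q * (q ^ k * norm (Y *v v))"
      by (rule mult_left_mono[OF Suc]) (use q in simp)
    finally show ?case by (simp add: ac_simps)
  qed simp
  obtain C where C: "\<And>v. norm (Y *v v) \<le> norm v * C"
    using bounded_linear.bounded[OF op_vec.bounded_linear_right[of Y]] by blast
  have *: "norm ((?f ^^ k) Y) \<le> real CARD('n) * real CARD('n) * (q ^ k * C)" for k
  proof (rule norm_op_le_of_bound)
    show "norm ((?f ^^ k) Y *v v) \<le> q ^ k * C * norm v" for v
      using bound[of k v] mult_left_mono[OF C[of v], of "q ^ k"] q by (simp add: ac_simps)
  qed
  have "(\<lambda>k. real CARD('n) * real CARD('n) * (q ^ k * C)) \<longlonglongrightarrow> real CARD('n) * real CARD('n) * (0 * C)"
    using q by (intro tendsto_mult_left tendsto_mult_right LIMSEQ_realpow_zero)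
  then have "(\<lambda>k. real CARD('n) * real CARD('n) * (q ^ k * C)) \<longlonglongrightarrow> 0" by simp
  then have "(\<lambda>k. (?f ^^ k) Y) \<longlonglongrightarrow> 0"
    by (rule Lim_null_comparison[rotated]) (intro always_eventually allI *)
  then have "(\<lambda>k. X - Y + (?f ^^ k) Y) \<longlonglongrightarrow> X - Y + 0"
    by (intro tendsto_add tendsto_const)
  then show ?thesis unfolding split by (simp add: Y_def)
qed

subsection \<open>Lindbladians with prescribed Hamiltonian and replacement part\<close>

lemma inner_axis_mult: "(y *s axis i 1) \<bullet> u = Re (cnj y * u $ i)" for u :: "complex^'n::finite"
  by (simp add: inner_vec_def axis_def inner_complex_def if_distrib if_distribR cong: if_cong)

lemma adjoint_op_eq_iff: "adjoint_op Z = Z \<longleftrightarrow> (\<forall>a b. cnj (Z $ b $ a) = Z $ a $ b)"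
  by (simp add: vec_eq_iff)

text \<open>Cholesky elimination: each step clears one row and column of \<open>Z\<close>.\<close>

lemma psd_cholesky_on:
  fixes Z :: "'n::finite op"
  assumes "finite S" "psd Z" "\<And>a b. a \<notin> S \<Longrightarrow> Z $ a $ b = 0"
  shows "\<exists>\<phi> :: 'n \<Rightarrow> complex^'n. \<forall>a b. Z $ a $ b = (\<Sum>k\<in>S. \<phi> k $ a * cnj (\<phi> k $ b))"
  using assms
proof (induction S arbitrary: Z rule: finite_induct)
  case empty
  then show ?case by simp
next
  case (insert i S)
  have herm: "adjoint_op Z = Z" and pos: "\<And>v. 0 \<le> v \<bullet> (Z *v v)"
    using insert.prems by (auto simp: psd_def)
  have sym: "cnj (Z $ b $ a) = Z $ a $ b" for a b
    using herm by (simp add: adjoint_op_eq_iff)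
  define d where "d = Re (Z $ i $ i)"
  have Zii: "Z $ i $ i = of_real d"
    using sym[of i i] by (simp add: d_def complex_eq_iff)
  have col: "(Z *v (y *s axis i 1)) $ a = y * Z $ a $ i" for y a
    by (simp add: matrix_vector_mult_def axis_def if_distrib if_distribR cong: if_cong)
  have col1: "(Z *v axis i 1) $ a = Z $ a $ i" for a
    using col[of 1 a] by simp
  have d0: "0 \<le> d"
    using pos[of "1 *s axis i 1"] by (simp only: inner_axis_mult col) (simp add: d_def)
  \<comment> \<open>If the diagonal entry vanishes, the form is minimal at the basis vector, so the
    whole column vanishes.\<close>
  have zero: "Z $ a $ i = 0" if "d = 0" for a
  proof -
    have "Z *v (1 *s axis i 1) = 0"
    proof (rule op_vec_eq_0_of_nonneg[OF herm, of UNIV])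
      show "(1 *s axis i 1) \<bullet> (Z *v (1 *s axis i 1)) = 0"
        by (simp only: inner_axis_mult col) (simp add: that Zii)
    qed (use pos in auto)
    then show ?thesis using col[of 1 a] by simp
  qed
  \<comment> \<open>The rank-one operator of the scaled column agrees with \<open>Z\<close> in row
    and column \<open>i\<close>. For \<open>d = 0\<close> the convention \<open>1 / 0 = 0\<close>
    gives \<open>\<psi> = 0\<close>, in accordance with \<open>zero\<close>.\<close>
  define \<psi> where "\<psi> = (1 / sqrt d) *\<^sub>R (Z *v (1 *s axis i 1))"
  have \<psi>: "\<psi> $ a = Z $ a $ i / of_real (sqrt d)" for a
    by (simp add: \<psi>_def col1 scaleR_conv_of_real[where 'a=complex] divide_inverse mult.commute)
  have \<psi>\<psi>: "\<psi> $ a * cnj (\<psi> $ b) = Z $ a $ i * Z $ i $ b / of_real d" for a b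
    using d0 by (simp add: \<psi> sym of_real_mult[symmetric] del: of_real_mult)
  define Z' where "Z' = (\<chi> a b. Z $ a $ b - \<psi> $ a * cnj (\<psi> $ b))"
  have Z'i: "Z' $ a $ i = 0" "Z' $ i $ a = 0" for a
  proof -
    show "Z' $ a $ i = 0"
      by (cases "d = 0") (simp_all add: Z'_def \<psi>\<psi> zero Zii)
    have "Z $ i $ a = 0" if "d = 0" using sym[of a i] zero[OF that, of a] by simp
    then show "Z' $ i $ a = 0"
      by (cases "d = 0") (simp_all add: Z'_def \<psi>\<psi> zero Zii)
  qed
  have "psd Z'"
    unfolding psd_def
  proof (intro conjI allI)
    show "adjoint_op Z' = Z'"
      by (simp add: adjoint_op_eq_iff Z'_def sym mult.commute)
    fix v
    \<comment> \<open>Completing the square: this shift along the basis vector turns the form of the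
      Schur complement \<open>Z'\<close> at \<open>v\<close> into the form of \<open>Z\<close> at
      \<open>w\<close>.\<close>
    define y where "y = (Z *v v) $ i / of_real d"
    define w where "w = v - y *s axis i 1"
    have Zw: "Z *v w = Z' *v v"
    proof -
      have "(Z' *v v) $ a = (Z *v v) $ a - Z $ a $ i * y" for a
        by (simp add: matrix_vector_mult_def Z'_def \<psi>\<psi> y_def left_diff_distrib sum_subtractf
            sum_divide_distrib sum_distrib_left mult.assoc)
      then show ?thesis
        by (simp add: w_def op_vec.diff_right vec_eq_iff col mult.commute)
    qed
    have "(Z' *v v) $ i = 0" by (simp add: matrix_vector_mult_def Z'i)
    then have "v \<bullet> (Z' *v v) = w \<bullet> (Z *v w)"
      by (simp add: Zw) (simp add: w_def inner_diff_left inner_axis_mult)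
    then show "0 \<le> v \<bullet> (Z' *v v)" using pos[of w] by simp
  qed
  moreover have "Z' $ a $ b = 0" if "a \<notin> S" for a b
  proof (cases "a = i")
    case False
    then have "Z $ a $ c = 0" for c using insert.prems(2) that by simp
    then show ?thesis by (simp add: Z'_def \<psi>)
  qed (simp add: Z'i)
  ultimately obtain \<phi> where \<phi>: "\<And>a b. Z' $ a $ b = (\<Sum>k\<in>S. \<phi> k $ a * cnj (\<phi> k $ b))"
    using insert.IH by blast
  have "Z $ a $ b = (\<Sum>k\<in>insert i S. (\<phi>(i := \<psi>)) k $ a * cnj ((\<phi>(i := \<psi>)) k $ b))" for a b
  proof -
    have "(\<Sum>k\<in>S. (\<phi>(i := \<psi>)) k $ a * cnj ((\<phi>(i := \<psi>)) k $ b)) = Z' $ a $ b"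
      unfolding \<phi> by (rule sum.cong) (use insert.hyps in auto)
    then show ?thesis using insert.hyps by (simp add: Z'_def)
  qed
  then show ?case by blast
qed

lemma psd_cholesky:
  fixes Z :: "'n::finite op"
  assumes "psd Z"
  obtains \<phi> :: "'n \<Rightarrow> complex^'n" where "\<And>a b. Z $ a $ b = (\<Sum>k\<in>UNIV. \<phi> k $ a * cnj (\<phi> k $ b))"
  using psd_cholesky_on[of UNIV Z] assms by auto

section \<open>Generators and their jump operators\<close>

text \<open>For \<open>trace Z = 1\<close> the dissipative part is the channel replacing every state
  by \<open>Z\<close>, minus the identity. Pairing \<open>H\<close> with \<open>Z\<close> makes the
  generator bilinear in the pair and \<open>\<sigma>\<close>.\<close>

definition replacement_generator :: "'n::finite op \<times> 'n op \<Rightarrow> 'n op \<Rightarrow> 'n op" where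
  "replacement_generator = (\<lambda>(H, Z) \<sigma>. mat (- \<i>) ** (H ** \<sigma> - \<sigma> ** H)
     + (mat (trace \<sigma>) ** Z - mat (trace Z) ** \<sigma>))"

text \<open>
  The jump operators are \<open>|\<phi>\<^sub>k\<rangle>\<langle>l|\<close> for a decomposition \<open>Z = (\<Sum>k. |\<phi>\<^sub>k\<rangle>\<langle>\<phi>\<^sub>k|)\<close>
  and all basis vectors \<open>|l\<rangle>\<close>.
\<close>

lemma lindbladian_replacement_generator:
  fixes H Z :: "'n::finite op"
  assumes H: "adjoint_op H = H" and Z: "psd Z"
  shows "lindbladian (replacement_generator (H, Z))"
proof -
  obtain \<phi> :: "'n \<Rightarrow> complex^'n" where \<phi>: "\<And>a b. Z $ a $ b = (\<Sum>k\<in>UNIV. \<phi> k $ a * cnj (\<phi> k $ b))"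
    using psd_cholesky[OF Z] by metis
  \<comment> \<open>The definition of \<open>lindbladian\<close> numbers jumps from 1, so the pairs
    \<open>(k, l)\<close> are enumerated.\<close>
  obtain h where h: "bij_betw h {1..card (UNIV :: ('n \<times> 'n) set)} (UNIV :: ('n \<times> 'n) set)"
    using ex_bij_betw_nat_finite_1[of "UNIV :: ('n \<times> 'n) set"] by auto
  define m where "m = card (UNIV :: ('n \<times> 'n) set)"
  define E where "E = (\<lambda>(k, l). (\<chi> a b. if b = l then \<phi> k $ a else 0) :: 'n op)"
  have E: "E (k, l) $ a $ b = (if b = l then \<phi> k $ a else 0)" for k l a b
    by (simp add: E_def)
  have reindex: "(\<Sum>j=1..m. f (h j)) = (\<Sum>k\<in>UNIV. \<Sum>l\<in>UNIV. f (k, l))" for f :: "'n \<times> 'n \<Rightarrow> 'n op"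
    using sum.reindex_bij_betw[OF h, of f] by (simp add: m_def sum.cartesian_product)
  \<comment> \<open>Each jump yields \<open>\<sigma> $ l $ l\<close> times the rank-one operator of
    \<open>\<phi> k\<close>; summing over \<open>l\<close> produces the trace and summing over
    \<open>k\<close> produces \<open>Z\<close>.\<close>
  have gain: "(\<Sum>j=1..m. E (h j) ** \<sigma> ** adjoint_op (E (h j))) = mat (trace \<sigma>) ** Z" for \<sigma>
  proof -
    have "(E (k, l) ** \<sigma> ** adjoint_op (E (k, l))) $ a $ b = \<sigma> $ l $ l * (\<phi> k $ a * cnj (\<phi> k $ b))"
      for k l a b
      by (simp add: matrix_matrix_mult_def E if_distrib if_distribR cong: if_cong)
    moreover have "(mat (trace \<sigma>) ** Z) $ a $ b = trace \<sigma> * Z $ a $ b" for a b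
      by (simp add: matrix_matrix_mult_def mat_def if_distrib if_distribR cong: if_cong)
    ultimately show ?thesis
      unfolding reindex[of "\<lambda>p. E p ** \<sigma> ** adjoint_op (E p)"]
      by (simp add: vec_eq_iff \<phi> trace_def sum_distrib_left sum_distrib_right)
  qed
  \<comment> \<open>Each term is the squared norm of \<open>\<phi> k\<close> times the projection
    onto basis vector \<open>l\<close>; summing over \<open>l\<close> gives a scalar
    operator.\<close>
  have loss: "(\<Sum>j=1..m. adjoint_op (E (h j)) ** E (h j)) = mat (trace Z)"
  proof -
    have "(adjoint_op (E (k, l)) ** E (k, l)) $ a $ b =
        (if a = l then if b = l then \<Sum>c\<in>UNIV. \<phi> k $ c * cnj (\<phi> k $ c) else 0 else 0)" for k l a b
      by (auto simp add: matrix_matrix_mult_def E mult.commute)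
    moreover have "trace Z = (\<Sum>k\<in>UNIV. \<Sum>c\<in>UNIV. \<phi> k $ c * cnj (\<phi> k $ c))"
      unfolding trace_def \<phi> by (rule sum.swap)
    ultimately show ?thesis
      unfolding reindex[of "\<lambda>p. adjoint_op (E p) ** E p"]
      by (simp add: vec_eq_iff mat_def)
  qed
  have "replacement_generator (H, Z) \<sigma> = mat (- \<i>) ** (H ** \<sigma> - \<sigma> ** H) +
      (\<Sum>j=1..m. E (h j) ** \<sigma> ** adjoint_op (E (h j)) - (1/2) *\<^sub>R (adjoint_op (E (h j)) ** E (h j) ** \<sigma>
        + \<sigma> ** adjoint_op (E (h j)) ** E (h j)))" for \<sigma>
  proof -
    have "(\<Sum>j=1..m. adjoint_op (E (h j)) ** E (h j) ** \<sigma>) = mat (trace Z) ** \<sigma>"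
      unfolding op_mult.sum_left[symmetric] loss ..
    moreover have "(\<Sum>j=1..m. \<sigma> ** adjoint_op (E (h j)) ** E (h j)) = mat (trace Z) ** \<sigma>"
      unfolding matrix_mul_assoc[symmetric] op_mult.sum_right[symmetric] loss
      by (rule mat_mult_commute[symmetric])
    moreover note gain[of \<sigma>]
    ultimately show ?thesis
      by (simp add: sum_subtractf scaleR_sum_right[symmetric] sum.distrib
          replacement_generator_def scaleR_2[symmetric])
  qed
  then show ?thesis
    unfolding lindbladian_def using H by (intro exI[of _ H] exI[of _ m] exI[of _ "\<lambda>j. E (h j)"]) simp
qed

text \<open>Supplies the value of the lifting on the exceptional null set.\<close>

lemma lindbladian_0: "lindbladian (\<lambda>\<sigma>. 0)"
  unfolding lindbladian_def by (intro exI[of _ 0] exI[of _ "0::nat"]) (simp add: adjoint_op_0)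

section \<open>Linear dependence of the generator on its data\<close>

lemma bounded_bilinear_replacement_generator:
  "bounded_bilinear (replacement_generator :: 'n::finite op \<times> 'n op \<Rightarrow> _)"
proof -
  have tr: "bounded_linear (\<lambda>A. mat (trace A) :: 'n op)"
    unfolding linear_conv_bounded_linear[symmetric]
    by (auto intro!: linearI simp: vec_eq_iff mat_def trace_add trace_scaleR
        scaleR_conv_of_real[where 'a=complex])
  interpret tr: bounded_linear "\<lambda>A. mat (trace A) :: 'n op" by (rule tr)
  show ?thesis
    unfolding bilinear_conv_bounded_bilinear[symmetric] bilinear_def replacement_generator_def
    by (auto intro!: linearI simp: op_mult.add_left op_mult.add_right op_mult.diff_right
        op_mult.scaleR_left op_mult.scaleR_right tr.add tr.scaleR algebra_simps)
qed

definition replacement_blinfun :: "'n::finite op \<times> 'n op \<Rightarrow> 'n op \<Rightarrow>\<^sub>L 'n op" where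
  "replacement_blinfun x = Blinfun (replacement_generator x)"

lemma replacement_blinfun_apply: "blinfun_apply (replacement_blinfun x) = replacement_generator x"
  unfolding replacement_blinfun_def
  by (rule bounded_linear_Blinfun_apply)
    (rule bounded_bilinear.bounded_linear_right[OF bounded_bilinear_replacement_generator])

text \<open>Transfers measurability and norm bounds from the pair \<open>(H, Z)\<close> to the
  superoperator.\<close>

lemma bounded_linear_replacement_blinfun: "bounded_linear replacement_blinfun"
  using transfer_bounded_bilinear_bounded_linearI[of replacement_generator replacement_blinfun]
    bounded_bilinear_replacement_generator by (auto simp: replacement_blinfun_apply)

subsection \<open>Derivatives of paths of states\<close>

lemma bounded_linear_trace: "bounded_linear (trace :: 'n::finite op \<Rightarrow> complex)"
  unfolding linear_conv_bounded_linear[symmetric]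
  by (auto intro!: linearI simp: trace_add trace_scaleR scaleR_conv_of_real[where 'a=complex])

text \<open>At an interior point the derivative is two-sided: the linear constraints on states
  differentiate directly, and a minimum of the form forces its derivative to be zero instead of
  merely having a sign.\<close>

lemma
  fixes \<rho> :: "real \<Rightarrow> 'n::finite op"
  assumes t: "t \<in> interior I" and st: "\<And>s. s \<in> I \<Longrightarrow> \<rho> s \<in> states"
    and deriv: "(\<rho> has_vector_derivative X) (at t within I)"
  defines "P \<equiv> mat 1 - support_proj (\<rho> t)"
  shows state_path_deriv_hermitian: "adjoint_op X = X"
    and state_path_deriv_trace: "trace X = 0"
    and state_path_deriv_kernel: "P ** X ** P = 0"
proof -
  have D: "(\<rho> has_vector_derivative X) (at t)"
    using deriv by (simp add: at_within_interior[OF t])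
  have st': "\<rho> s \<in> states" if "s \<in> interior I" for s
    using st that interior_subset by blast
  have "((\<lambda>s. adjoint_op (\<rho> s)) has_vector_derivative adjoint_op X) (at t)"
    by (rule bounded_linear.has_vector_derivative[OF bounded_linear_adjoint_op D])
  then have "(\<rho> has_vector_derivative adjoint_op X) (at t)"
    by (rule has_vector_derivative_transform_within_open[OF _ open_interior t])
      (use st' in \<open>simp add: states_def\<close>)
  then show herm: "adjoint_op X = X" by (rule vector_derivative_unique_at[OF _ D])
  have "((\<lambda>s. trace (\<rho> s)) has_vector_derivative trace X) (at t)"
    by (rule bounded_linear.has_vector_derivative[OF bounded_linear_trace D])
  then have "((\<lambda>s. 1) has_vector_derivative trace X) (at t)"
    by (rule has_vector_derivative_transform_within_open[OF _ open_interior t])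
      (use st' in \<open>simp add: states_def\<close>)
  from vector_derivative_unique_at[OF this has_vector_derivative_const] show "trace X = 0" .
  have psd: "psd (\<rho> s)" if "s \<in> interior I" for s
    using st'[OF that] by (rule states_psd)
  have herm_t: "adjoint_op (\<rho> t) = \<rho> t" using psd[OF t] by (simp add: psd_def)
  have adjP: "adjoint_op P = P"
    by (simp add: P_def adjoint_op_diff adjoint_op_mat adjoint_support_proj[OF herm_t])
  have "v \<bullet> ((P ** X ** P) *v v) = 0" for v
  proof -
    define w where "w = P *v v"
    have "\<rho> t ** P = 0"
      by (simp add: P_def op_mult.diff_right mult_support_proj[OF herm_t])
    then have "\<rho> t *v w = 0" by (simp add: w_def matrix_vector_mul_assoc)
    have "bounded_linear (\<lambda>A. w \<bullet> (A *v w))"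
      by (rule bounded_linear_compose[OF bounded_linear_inner_right op_vec.bounded_linear_left])
    from bounded_linear.has_vector_derivative[OF this D]
    have "((\<lambda>s. w \<bullet> (\<rho> s *v w)) has_real_derivative w \<bullet> (X *v w)) (at t)"
      by (simp add: has_real_derivative_iff_has_vector_derivative)
    note D' = this
    obtain e where e: "0 < e" "ball t e \<subseteq> interior I"
      using t open_interior open_contains_ball by metis
    have min: "\<forall>s. \<bar>t - s\<bar> < e \<longrightarrow> w \<bullet> (\<rho> t *v w) \<le> w \<bullet> (\<rho> s *v w)"
    proof (intro allI impI)
      fix s assume "\<bar>t - s\<bar> < e"
      then have "s \<in> interior I" using e by (auto simp: ball_def dist_real_def)
      from psd[OF this] show "w \<bullet> (\<rho> t *v w) \<le> w \<bullet> (\<rho> s *v w)"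
        by (simp add: \<open>\<rho> t *v w = 0\<close> psd_def)
    qed
    have "w \<bullet> (X *v w) = 0" by (rule DERIV_local_min[OF D' e(1) min])
    moreover have "v \<bullet> ((P ** X ** P) *v v) = v \<bullet> (P *v (X *v w))"
      by (simp add: w_def matrix_vector_mul_assoc matrix_mul_assoc)
    ultimately show ?thesis
      by (simp add: inner_adjoint_op[of v P] adjP w_def)
  qed
  moreover have "adjoint_op (P ** X ** P) = P ** X ** P"
    by (simp add: adjoint_op_mult adjP herm matrix_mul_assoc)
  \<comment> \<open>A Hermitian operator with zero form is zero, by minimality on the whole
    space.\<close>
  ultimately have "(P ** X ** P) *v v = 0" for v
    by (intro op_vec_eq_0_of_nonneg[of _ UNIV]) simp_all
  then show "P ** X ** P = 0" by (simp add: matrix_eq)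
qed

subsection \<open>The lifting of a single tangent vector\<close>

definition lift_hamiltonian :: "'n::finite op \<Rightarrow> 'n op \<Rightarrow> 'n op" where
  "lift_hamiltonian A X = (let K = (mat 1 - support_proj A) ** X ** pseudo_inverse A
     in mat \<i> ** (K - adjoint_op K))"

definition lift_replacement :: "real \<Rightarrow> 'n::finite op \<Rightarrow> 'n op \<Rightarrow> 'n op" where
  "lift_replacement M A X =
     (M * inverse (spectral_gap A)) *\<^sub>R A + support_proj A ** X ** support_proj A"

lemma adjoint_lift_hamiltonian: "adjoint_op (lift_hamiltonian A X) = lift_hamiltonian A X"
proof -
  have "adjoint_op (mat \<i> ** D) = mat \<i> ** D" if "adjoint_op D = - D" for D :: "'a op"
  proof -
    have "adjoint_op (mat \<i> ** D) = mat (- \<i>) ** (- D)"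
      by (simp add: adjoint_op_mult adjoint_op_mat that mat_mult_commute)
    also have "mat (- \<i>) = - (mat \<i> :: 'a op)" by (simp add: vec_eq_iff mat_def)
    finally show ?thesis by (simp add: op_mult.minus_left op_mult.minus_right)
  qed
  then show ?thesis by (simp add: lift_hamiltonian_def Let_def adjoint_op_diff)
qed

text \<open>On the support \<open>A\<close> is at least its gap, so the multiple of \<open>A\<close>
  dominates the bound \<open>M\<close> on the compression of \<open>X\<close>; off the support both
  terms vanish.\<close>

lemma psd_lift_replacement:
  fixes A X :: "'n::finite op"
  assumes psd: "psd A" and nz: "A \<noteq> 0" and X: "adjoint_op X = X"
    and M: "\<And>u. norm (X *v u) \<le> M * norm u"
  shows "psd (lift_replacement M A X)"
  unfolding psd_def
proof (intro conjI allI)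
  have herm: "adjoint_op A = A" using psd by (simp add: psd_def)
  let ?Q = "support_proj A" and ?g = "spectral_gap A"
  note Q = adjoint_support_proj[OF herm]
  show "adjoint_op (lift_replacement M A X) = lift_replacement M A X"
    by (simp add: lift_replacement_def adjoint_op_add adjoint_op_scaleR adjoint_op_mult herm Q X
        matrix_mul_assoc)
  fix v
  define u where "u = ?Q *v v"
  \<comment> \<open>Any unit vector shows that \<open>M\<close> is nonnegative;
    \<open>undefined\<close> merely picks an index.\<close>
  have "M * norm (axis undefined 1 :: complex^'n) \<ge> 0"
    by (rule order_trans[OF norm_ge_zero M])
  then have M0: "0 \<le> M" by simp
  have Qu: "?Q *v u = u"
    by (simp add: u_def matrix_vector_mul_assoc support_proj_idem[OF herm])
  have "A = ?Q ** A ** ?Q"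
    by (simp add: support_proj_mult[OF herm] mult_support_proj[OF herm])
  then have "A *v v = ?Q *v (A *v u)"
    by (simp add: u_def matrix_vector_mul_assoc matrix_mul_assoc)
  then have 1: "v \<bullet> (A *v v) = u \<bullet> (A *v u)"
    by (simp add: inner_adjoint_op[of v ?Q] Q u_def)
  have "(?Q ** X ** ?Q) *v v = ?Q *v (X *v u)"
    by (simp add: u_def matrix_vector_mul_assoc matrix_mul_assoc)
  then have 2: "v \<bullet> ((?Q ** X ** ?Q) *v v) = u \<bullet> (X *v u)"
    by (simp add: inner_adjoint_op[of v ?Q] Q u_def)
  have "\<bar>u \<bullet> (X *v u)\<bar> \<le> norm u * norm (X *v u)" by (rule Cauchy_Schwarz_ineq2)
  also have "\<dots> \<le> norm u * (M * norm u)" by (rule mult_left_mono[OF M]) simp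
  also have "\<dots> = M * inverse ?g * (?g * (u \<bullet> u))"
    using spectral_gap_pos[OF psd nz] by (simp add: dot_square_norm power2_eq_square)
  also have "\<dots> \<le> M * inverse ?g * (u \<bullet> (A *v u))"
    using spectral_gap_pos[OF psd nz] M0 by (intro mult_left_mono spectral_gap_le[OF psd nz Qu]) simp
  finally show "0 \<le> v \<bullet> (lift_replacement M A X *v v)"
    by (simp add: lift_replacement_def op_vec.add_left op_vec.scaleR_left inner_add_right 1 2)
qed

text \<open>\<open>K ** A\<close> and \<open>A ** adjoint_op K\<close> are the two off-diagonal
  blocks of \<open>X\<close>, and the opposite products vanish. As \<open>trace A = 1\<close>, the
  loss term cancels the multiple of \<open>A\<close> and leaves the support block.\<close>

lemma replacement_generator_lift:
  fixes A X :: "'n::finite op"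
  assumes herm: "adjoint_op A = A" and trA: "trace A = 1"
    and X: "adjoint_op X = X" and trX: "trace X = 0"
    and ker: "(mat 1 - support_proj A) ** X ** (mat 1 - support_proj A) = 0"
  shows "replacement_generator (lift_hamiltonian A X, lift_replacement M A X) A = X"
proof -
  define Q P S where "Q = support_proj A" and "P = mat 1 - Q" and "S = pseudo_inverse A"
  define K where "K = P ** X ** S"
  define c where "c = M * inverse (spectral_gap A)"
  have adjQ: "adjoint_op Q = Q" and QQ: "Q ** Q = Q" and SA: "S ** A = Q" and AS: "A ** S = Q"
    using adjoint_support_proj[OF herm] support_proj_idem[OF herm] pseudo_inverse_mult[OF herm]
    by (simp_all add: Q_def S_def support_proj_def)
  have adjS: "adjoint_op S = S" using adjoint_pseudo_inverse[OF herm] by (simp add: S_def)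
  have adjP: "adjoint_op P = P" by (simp add: P_def adjoint_op_diff adjoint_op_mat adjQ)
  have PA: "P ** A = 0" and AP: "A ** P = 0"
    by (simp_all add: P_def Q_def op_mult.diff_left op_mult.diff_right support_proj_mult[OF herm]
        mult_support_proj[OF herm])
  have QP: "Q ** P = 0" by (simp add: P_def op_mult.diff_right QQ)
  have PQ: "P ** Q = 0" by (simp add: P_def op_mult.diff_left QQ)
  have PXP: "P ** X ** P = 0" using ker by (simp add: P_def Q_def)
  have split: "X = P ** X ** Q + Q ** X ** P + Q ** X ** Q"
  proof -
    have "X = (P + Q) ** X ** (P + Q)" by (simp add: P_def)
    also have "\<dots> = P ** X ** P + P ** X ** Q + Q ** X ** P + Q ** X ** Q"
      by (simp only: op_mult.add_left op_mult.add_right ac_simps)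
    finally show ?thesis by (simp add: PXP)
  qed
  \<comment> \<open>By cyclicity the off-diagonal blocks are traceless, so
    \<open>Q ** X ** Q\<close> inherits the zero trace of \<open>X\<close>.\<close>
  have "trace (P ** X ** Q) = 0"
    by (subst trace_mul_sym) (simp add: matrix_mul_assoc QP trace_def)
  moreover have "trace (Q ** X ** P) = 0"
    by (subst matrix_mul_assoc[symmetric], subst trace_mul_sym)
      (simp add: matrix_mul_assoc[symmetric] PQ trace_def)
  ultimately have trY: "trace (Q ** X ** Q) = 0"
    using trX arg_cong[OF split, of trace] by (simp add: trace_add)
  have trZ: "trace (lift_replacement M A X) = of_real c"
    using trY by (simp add: lift_replacement_def trace_add trace_scaleR trA Q_def c_def)
  have adjK: "adjoint_op K = S ** X ** P"
    by (simp add: K_def adjoint_op_mult adjS adjP X matrix_mul_assoc)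
  have 1: "K ** A = P ** X ** Q" by (simp add: K_def matrix_mul_assoc[symmetric] SA)
  have 2: "A ** K = 0" by (simp add: K_def matrix_mul_assoc AP)
  have 3: "adjoint_op K ** A = 0" by (simp add: adjK matrix_mul_assoc[symmetric] PA)
  have 4: "A ** adjoint_op K = Q ** X ** P" by (simp add: adjK matrix_mul_assoc AS)
  have ii: "mat (- \<i>) ** mat \<i> = (mat 1 :: 'n op)"
    by (simp add: vec_eq_iff mat_mult_nth) (simp add: mat_def)
  have mat_real: "mat (of_real c) ** A = c *\<^sub>R A"
    by (simp add: vec_eq_iff mat_mult_nth scaleR_conv_of_real[where 'a=complex])
  define D where "D = K - adjoint_op K"
  have H: "lift_hamiltonian A X = mat \<i> ** D"
    by (simp add: lift_hamiltonian_def Let_def D_def K_def P_def Q_def S_def)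
  have "mat (- \<i>) ** (mat \<i> ** D ** A - A ** (mat \<i> ** D)) = D ** A - A ** D"
  proof -
    have "A ** (mat \<i> ** D) = mat \<i> ** (A ** D)"
      by (simp only: matrix_mul_assoc mat_mult_commute[of \<i> A])
    then show ?thesis
      by (simp add: op_mult.diff_right matrix_mul_assoc ii)
  qed
  also have "\<dots> = P ** X ** Q + Q ** X ** P"
    by (simp add: D_def op_mult.diff_left op_mult.diff_right 1 2 3 4)
  finally have "replacement_generator (lift_hamiltonian A X, lift_replacement M A X) A
      = P ** X ** Q + Q ** X ** P + (lift_replacement M A X - c *\<^sub>R A)"
    by (simp add: replacement_generator_def H trA trZ mat_real)
  also have "\<dots> = X"
    by (subst (4) split) (simp add: lift_replacement_def Q_def c_def)
  finally show ?thesis .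
qed

subsection \<open>Norm bounds\<close>

text \<open>Test the bound on an eigenvector for the gap. The result lets constant terms be absorbed
  into multiples of the inverse gap.\<close>

lemma spectral_gap_le_norm:
  fixes A :: "'n::finite op"
  assumes "psd A" "A \<noteq> 0" and b: "\<And>u. norm (A *v u) \<le> b * norm u"
  shows "spectral_gap A \<le> b"
proof -
  obtain v where "v \<noteq> 0" "A *v v = spectral_gap A *\<^sub>R v"
    using spectral_gap_eigenvector[OF assms(1,2)] by blast
  then show ?thesis
    using b[of v] spectral_gap_pos[OF assms(1,2)] by simp
qed

text \<open>For a Hermitian idempotent the squared norm of the image is its inner product with
  \<open>v\<close>. The factor \<open>1\<close> fits the shape of
  \<open>norm_op_le_of_bound\<close>.\<close>

lemma norm_support_proj_vec:
  fixes A :: "'n::finite op"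
  assumes herm: "adjoint_op A = A"
  shows "norm (support_proj A *v v) \<le> 1 * norm v"
proof -
  let ?u = "support_proj A *v v"
  have "?u \<bullet> ?u = ?u \<bullet> v"
    using inner_adjoint_op[of ?u "support_proj A" v]
    by (simp add: adjoint_support_proj[OF herm] matrix_vector_mul_assoc support_proj_idem[OF herm])
  then have "norm ?u * norm ?u \<le> norm ?u * norm v"
    using norm_cauchy_schwarz[of ?u v] by (simp add: dot_square_norm power2_eq_square)
  then show ?thesis by (cases "norm ?u = 0") simp_all
qed

text \<open>\<open>D\<close> is uniform in \<open>A\<close> and \<open>X\<close>, so along the path
  the inverse gap alone governs integrability.\<close>

lemma norm_lift_le:
  fixes B C M :: real
  assumes C: "0 \<le> C" and M: "0 \<le> M"
  obtains D where "\<And>(A :: 'n::finite op) X. psd A \<Longrightarrow> A \<noteq> 0 \<Longrightarrow> norm A \<le> B \<Longrightarrow> norm X \<le> C \<Longrightarrow>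
    norm (replacement_blinfun (lift_hamiltonian A X, lift_replacement M A X))
      \<le> D * inverse (spectral_gap A)"
proof -
  define N where "N = real CARD('n) * real CARD('n)"
  obtain k where k: "0 \<le> k" "\<And>(E :: 'n op) (F :: 'n op). norm (E ** F) \<le> norm E * norm F * k"
    using op_mult.nonneg_bounded by blast
  obtain kv where kv: "0 \<le> kv" "\<And>(A :: 'n op) v. norm (A *v v) \<le> norm A * norm v * kv"
    using op_vec.nonneg_bounded by blast
  obtain ka where ka: "0 \<le> ka" "\<And>A :: 'n op. norm (adjoint_op A) \<le> norm A * ka"
    using bounded_linear.nonneg_bounded[OF bounded_linear_adjoint_op] by blast
  obtain kr where kr: "0 \<le> kr" "\<And>x :: 'n op \<times> 'n op. norm (replacement_blinfun x) \<le> norm x * kr"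
    using bounded_linear.nonneg_bounded[OF bounded_linear_replacement_blinfun] by blast
  have mult: "norm (E ** F) \<le> a * b * k" if "norm E \<le> a" "norm F \<le> b" for E F :: "'n op" and a b
  proof -
    have "0 \<le> a" by (rule order_trans[OF norm_ge_zero that(1)])
    have "norm (E ** F) \<le> norm E * norm F * k" by (rule k)
    also have "\<dots> \<le> a * b * k"
      by (intro mult_right_mono mult_mono that k) (use \<open>0 \<le> a\<close> in simp_all)
    finally show ?thesis .
  qed
  define p where "p = norm (mat 1 :: 'n op) + N"
  define DK where "DK = p * C * k * N * k"
  define D1 where "D1 = norm (mat \<i> :: 'n op) * (DK + DK * ka) * k"
  define D2 where "D2 = M * B + N * C * k * N * k * (kv * B)"
  have bound: "norm (replacement_blinfun (lift_hamiltonian A X, lift_replacement M A X))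
      \<le> (D1 + D2) * kr * inverse (spectral_gap A)"
    if A: "psd A" "A \<noteq> 0" "norm A \<le> B" and X: "norm X \<le> C" for A X :: "'n op"
  proof -
    define g where "g = inverse (spectral_gap A)"
    have gap: "0 < spectral_gap A" by (rule spectral_gap_pos[OF A(1,2)])
    then have g: "0 \<le> g" by (simp add: g_def)
    have "norm (A *v u) \<le> kv * B * norm u" for u
    proof -
      have "norm (A *v u) \<le> norm A * norm u * kv" by (rule kv)
      also have "\<dots> \<le> B * norm u * kv"
        by (intro mult_right_mono A kv) simp
      finally show ?thesis by (simp add: ac_simps)
    qed
    then have "spectral_gap A \<le> kv * B" by (rule spectral_gap_le_norm[OF A(1,2)])
    \<comment> \<open>Used to absorb the constant bound on the support block into a multiple of
      \<open>g\<close>.\<close>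
    then have one: "1 \<le> kv * B * g" using gap by (simp add: g_def field_simps)
    have herm: "adjoint_op A = A" using A by (simp add: psd_def)
    have Q: "norm (support_proj A) \<le> N"
      using norm_op_le_of_bound[OF norm_support_proj_vec[OF herm]] by (simp add: N_def)
    have S: "norm (pseudo_inverse A) \<le> N * g"
      using norm_op_le_of_bound[OF norm_pseudo_inverse_vec[OF A(1,2)]] by (simp add: N_def g_def)
    have P: "norm (mat 1 - support_proj A) \<le> p"
      unfolding p_def by (rule order_trans[OF norm_triangle_ineq4]) (use Q in simp)
    define K where "K = (mat 1 - support_proj A) ** X ** pseudo_inverse A"
    have K: "norm K \<le> DK * g"
      using mult[OF mult[OF P X] S] by (simp add: K_def DK_def ac_simps)
    have "norm (K - adjoint_op K) \<le> norm K + norm K * ka"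
      by (rule order_trans[OF norm_triangle_ineq4]) (use ka in simp)
    also have "\<dots> \<le> DK * g + DK * g * ka"
      by (intro add_mono mult_right_mono K ka)
    finally have "norm (mat \<i> ** (K - adjoint_op K)) \<le> norm (mat \<i> :: 'n op) * (DK * g + DK * g * ka) * k"
      by (intro mult) simp_all
    then have H: "norm (lift_hamiltonian A X) \<le> D1 * g"
      by (simp add: lift_hamiltonian_def K_def[symmetric] D1_def algebra_simps)
    have "norm ((M * g) *\<^sub>R A) \<le> M * g * B"
      using A(3) M g by (simp add: mult_left_mono)
    moreover have "norm (support_proj A ** X ** support_proj A) \<le> N * C * k * N * k"
      by (rule mult[OF mult[OF Q X] Q])
    moreover have "N * C * k * N * k * 1 \<le> N * C * k * N * k * (kv * B * g)"
      by (rule mult_left_mono[OF one]) (use C k in \<open>simp add: N_def\<close>)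
    ultimately have Z: "norm (lift_replacement M A X) \<le> D2 * g"
      unfolding lift_replacement_def g_def[symmetric]
      by (intro order_trans[OF norm_triangle_ineq]) (simp add: D2_def algebra_simps)
    have "norm (lift_hamiltonian A X, lift_replacement M A X) \<le> (D1 + D2) * g"
      using norm_Pair_le[of "lift_hamiltonian A X" "lift_replacement M A X"] H Z
      by (simp add: algebra_simps)
    then have "norm (lift_hamiltonian A X, lift_replacement M A X) * kr \<le> (D1 + D2) * g * kr"
      by (rule mult_right_mono[OF _ kr(1)])
    then show ?thesis
      using kr(2)[of "(lift_hamiltonian A X, lift_replacement M A X)"]
      by (simp add: g_def ac_simps)
  qed
  then show ?thesis by (rule that)
qed

subsection \<open>Measurability\<close>

lemma borel_measurable_op_mult:
  fixes f g :: "'a \<Rightarrow> 'n::finite op"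
  assumes "f \<in> borel_measurable M" "g \<in> borel_measurable M"
  shows "(\<lambda>x. f x ** g x) \<in> borel_measurable M"
  using assms
  by (rule borel_measurable_continuous_Pair) (intro op_mult.continuous_on continuous_intros)

text \<open>The choice operator in \<open>pseudo_inverse\<close> says nothing about measurability,
  so both operators are exhibited as pointwise limits of measurable iterations.\<close>

lemma
  fixes A :: "'a \<Rightarrow> 'n::finite op"
  assumes A: "A \<in> borel_measurable M" and g: "(\<lambda>x. spectral_gap (A x)) \<in> borel_measurable M"
    and psd: "\<And>x. x \<in> space M \<Longrightarrow> psd (A x)" and nz: "\<And>x. x \<in> space M \<Longrightarrow> A x \<noteq> 0"
  shows borel_measurable_support_proj: "(\<lambda>x. support_proj (A x)) \<in> borel_measurable M"
    and borel_measurable_pseudo_inverse: "(\<lambda>x. pseudo_inverse (A x)) \<in> borel_measurable M"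
proof -
  obtain kv where kv: "\<And>(B :: 'n op) v. norm (B *v v) \<le> norm B * norm v * kv"
    using op_vec.nonneg_bounded by blast
  define b where "b x = kv * norm (A x)" for x
  \<comment> \<open>This step size is positive and meets the contraction condition; the
    \<open>1 +\<close> guards against a zero denominator.\<close>
  define a where "a x = spectral_gap (A x) / (1 + (b x)\<^sup>2)" for x
  have a: "a \<in> borel_measurable M" unfolding a_def b_def using A g by measurable
  define f where "f x Y = Y - a x *\<^sub>R (A x ** Y)" for x and Y :: "'n op"
  note [measurable] = A a borel_measurable_op_mult
  have iter: "(\<lambda>k. (f x ^^ k) Y) \<longlonglongrightarrow> Y - support_proj (A x) ** Y" if x: "x \<in> space M" for x and Y :: "'n op"
    unfolding f_def
  proof (rule gradient_iteration_tendsto[OF psd[OF x] nz[OF x]])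
    show "norm (A x *v u) \<le> b x * norm u" for u
      using kv[of "A x" u] by (simp add: b_def ac_simps)
    have "0 < 1 + (b x)\<^sup>2" by (simp add: add_pos_nonneg)
    then show "0 < a x" "a x * (b x)\<^sup>2 \<le> spectral_gap (A x)"
      using spectral_gap_pos[OF psd[OF x] nz[OF x]] by (simp_all add: a_def field_simps)
  qed
  \<comment> \<open>Started at the identity, the iteration tends to the kernel projection.\<close>
  have "(\<lambda>x. (f x ^^ k) (mat 1)) \<in> borel_measurable M" for k
  proof (induction k)
    case (Suc k)
    then show ?case by (simp add: f_def borel_measurable_op_mult)
  qed simp
  then have "(\<lambda>x. mat 1 - support_proj (A x) ** mat 1) \<in> borel_measurable M"
    by (rule borel_measurable_LIMSEQ_metric) (rule iter)
  then have "(\<lambda>x. mat 1 - (mat 1 - support_proj (A x) ** mat 1)) \<in> borel_measurable M"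
    by measurable
  then show Q [measurable]: "(\<lambda>x. support_proj (A x)) \<in> borel_measurable M" by simp
  \<comment> \<open>Iterating on the pseudo-inverse would presuppose its measurability. The
    difference \<open>T\<close> starts at 0 and obeys a recursion in \<open>A\<close> and the
    support projection only.\<close>
  define T where "T k x = pseudo_inverse (A x) - (f x ^^ k) (pseudo_inverse (A x))" for k x
  have T_Suc: "T (Suc k) x = T k x + a x *\<^sub>R (support_proj (A x) - A x ** T k x)" for k x
    by (simp add: T_def f_def op_mult.diff_right support_proj_def)
  have "T k \<in> borel_measurable M" for k
  proof (induction k)
    case 0
    have "T 0 = (\<lambda>x. 0)" by (simp add: T_def fun_eq_iff)
    then show ?case by simp
  next
    case (Suc k)
    have "T (Suc k) = (\<lambda>x. T k x + a x *\<^sub>R (support_proj (A x) - A x ** T k x))"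
      by (simp add: T_Suc fun_eq_iff)
    then show ?case using Suc by (simp add: borel_measurable_op_mult)
  qed
  then show "(\<lambda>x. pseudo_inverse (A x)) \<in> borel_measurable M"
  proof (rule borel_measurable_LIMSEQ_metric)
    fix x assume x: "x \<in> space M"
    have herm: "adjoint_op (A x) = A x" using psd[OF x] by (simp add: psd_def)
    have "(\<lambda>k. T k x) \<longlonglongrightarrow> pseudo_inverse (A x) -
        (pseudo_inverse (A x) - support_proj (A x) ** pseudo_inverse (A x))"
      unfolding T_def by (intro tendsto_diff tendsto_const iter x)
    then show "(\<lambda>k. T k x) \<longlonglongrightarrow> pseudo_inverse (A x)"
      by (simp add: support_proj_pseudo_inverse[OF herm])
  qed
qed

text \<open>The frontier of a convex set is negligible; this discards endpoints, where derivatives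
  are one-sided.\<close>

lemma AE_interior_interval:
  fixes I :: "real set"
  assumes "is_interval I"
  shows "AE t in lebesgue_on I. t \<in> interior I"
proof -
  have "negligible (I - interior I)"
    by (rule negligible_subset[OF negligible_convex_frontier[OF is_interval_convex[OF assms]]])
      (use closure_subset in \<open>auto simp: frontier_def\<close>)
  then have null: "I - interior I \<in> null_sets lebesgue"
    by (simp add: negligible_iff_null_sets)
  have "I = interior I \<union> (I - interior I)" using interior_subset by blast
  then have "I \<in> sets lebesgue"
    using null by (metis borel_open lborelD null_setsD2 open_interior sets.Un sets_completionI_sets)
  then show ?thesis
    using AE_not_in[OF null] by (simp add: AE_restrict_space_iff)
qed

section \<open>Assembly of the lifting along the path\<close>

theorem proposition3p6:
  fixes I :: "real set"
    and \<rho> \<rho>' :: "real \<Rightarrow> 'n::finite op"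
  assumes "is_interval I"
    and "\<And>t. t \<in> I \<Longrightarrow> \<rho> t \<in> states"
    and "AE t in lebesgue_on I. (\<rho> has_vector_derivative \<rho>' t) (at t within I)"
    and "AE t in lebesgue_on I. invertible (\<rho>' t)"
    and "in_Linf I \<rho>"
    and "in_Linf I \<rho>'"
    and "in_Linf I (\<lambda>t. matrix_inv (\<rho>' t))"
    and "AE t in lebesgue_on I. \<rho>' t \<in> tangent_cone (\<rho> t)"
    and "integrable (lebesgue_on I) (\<lambda>t. inverse (spectral_gap (\<rho> t)))"
    and "integrable (lebesgue_on I) (\<lambda>t. sqrt (inverse (spectral_gap (\<rho> t))))"
  shows "\<exists>L :: real \<Rightarrow> 'n op \<Rightarrow>\<^sub>L 'n op.
    (\<forall>t\<in>I. lindbladian (blinfun_apply (L t))) \<and>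
    (AE t in lebesgue_on I. L t (\<rho> t) = \<rho>' t) \<and>
    integrable (lebesgue_on I) L"
proof -
  let ?M = "lebesgue_on I"
  have meas [measurable]: "\<rho> \<in> borel_measurable ?M" "\<rho>' \<in> borel_measurable ?M"
    using assms(5,6) by (simp_all add: in_Linf_def)
  obtain B C where "AE t in ?M. norm (\<rho> t) \<le> B" "AE t in ?M. norm (\<rho>' t) \<le> C"
    using assms(5,6) by (auto simp: in_Linf_def)
  \<comment> \<open>Raising the essential bounds to at least 0 provides the nonnegativity that the
    norm estimate requires of its constants.\<close>
  with assms(3) AE_interior_interval[OF assms(1)]
  have "AE t in ?M. t \<in> interior I \<and> (\<rho> has_vector_derivative \<rho>' t) (at t within I) \<and>
      norm (\<rho> t) \<le> max 0 B \<and> norm (\<rho>' t) \<le> max 0 C"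
    by eventually_elim auto
  \<comment> \<open>A single null set collects all exceptional times, so that the lifting can be
    defined pointwise off it.\<close>
  then obtain N where N: "N \<in> null_sets ?M" and good: "\<And>t. t \<in> I - N \<Longrightarrow>
      t \<in> interior I \<and> (\<rho> has_vector_derivative \<rho>' t) (at t within I) \<and>
      norm (\<rho> t) \<le> max 0 B \<and> norm (\<rho>' t) \<le> max 0 C"
    by (rule AE_E3) (simp add: space_restrict_space)
  obtain kv where kv: "0 \<le> kv" "\<And>(A :: 'n op) v. norm (A *v v) \<le> norm A * norm v * kv"
    using op_vec.nonneg_bounded by blast
  define K where "K = max 0 C * kv"
  have K: "norm (\<rho>' t *v u) \<le> K * norm u" if "t \<in> I - N" for t u
  proof -
    have "norm (\<rho>' t *v u) \<le> norm (\<rho>' t) * norm u * kv" by (rule kv)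
    also have "\<dots> \<le> max 0 C * norm u * kv"
      using good[OF that] by (intro mult_right_mono kv) auto
    finally show ?thesis by (simp add: K_def ac_simps)
  qed
  define H Z where "H t = lift_hamiltonian (\<rho> t) (\<rho>' t)" and "Z t = lift_replacement K (\<rho> t) (\<rho>' t)" for t
  \<comment> \<open>The zero Lindbladian on \<open>N\<close> keeps \<open>L t\<close> a Lindbladian
    at every time in \<open>I\<close>, not just almost everywhere.\<close>
  define L where "L t = (if t \<in> N then 0 else replacement_blinfun (H t, Z t))" for t
  have psd: "psd (\<rho> t)" and tr: "trace (\<rho> t) = 1" and nz: "\<rho> t \<noteq> 0" if "t \<in> I" for t
    using assms(2)[OF that] by (auto simp: states_psd states_def trace_def)
  have herm: "adjoint_op (\<rho> t) = \<rho> t" if "t \<in> I" for t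
    using psd[OF that] by (simp add: psd_def)
  have deriv: "adjoint_op (\<rho>' t) = \<rho>' t" "trace (\<rho>' t) = 0"
      "(mat 1 - support_proj (\<rho> t)) ** \<rho>' t ** (mat 1 - support_proj (\<rho> t)) = 0" if "t \<in> I - N" for t
    using good[OF that] state_path_deriv_hermitian[of t I \<rho>] state_path_deriv_trace[of t I \<rho>]
      state_path_deriv_kernel[of t I \<rho>] assms(2) by blast+
  have "lindbladian (L t)" if "t \<in> I" for t
  proof (cases "t \<in> N")
    case True
    then show ?thesis by (simp add: L_def lindbladian_0 zero_blinfun.rep_eq)
  next
    case False
    with that have "t \<in> I - N" by simp
    with K have "psd (Z t)"
      unfolding Z_def using that by (intro psd_lift_replacement psd nz deriv) auto
    with False show ?thesis
      by (simp add: L_def replacement_blinfun_apply lindbladian_replacement_generator H_def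
          adjoint_lift_hamiltonian)
  qed
  moreover have AE_good: "AE t in ?M. t \<in> I - N"
    using AE_not_in[OF N] AE_space by eventually_elim (simp add: space_restrict_space)
  then have "AE t in ?M. L t (\<rho> t) = \<rho>' t"
    by eventually_elim (simp add: L_def H_def Z_def replacement_blinfun_apply
        replacement_generator_lift herm tr deriv)
  moreover have "integrable ?M L"
  proof -
    have ginv [measurable]: "(\<lambda>t. inverse (spectral_gap (\<rho> t))) \<in> borel_measurable ?M"
      using assms(9) by (rule borel_measurable_integrable)
    \<comment> \<open>Measurability of the gap itself is recovered from that of its integrable
      inverse.\<close>
    have "(\<lambda>t. inverse (inverse (spectral_gap (\<rho> t)))) \<in> borel_measurable ?M" by measurable
    then have g: "(\<lambda>t. spectral_gap (\<rho> t)) \<in> borel_measurable ?M" by simp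
    have Q [measurable]: "(\<lambda>t. support_proj (\<rho> t)) \<in> borel_measurable ?M"
      and S [measurable]: "(\<lambda>t. pseudo_inverse (\<rho> t)) \<in> borel_measurable ?M"
      using borel_measurable_support_proj[OF meas(1) g] borel_measurable_pseudo_inverse[OF meas(1) g]
        psd nz by (simp_all add: space_restrict_space)
    note [measurable] = borel_measurable_op_mult
      borel_measurable_continuous_on[OF linear_continuous_on[OF bounded_linear_adjoint_op]]
      borel_measurable_continuous_on[OF linear_continuous_on[OF bounded_linear_replacement_blinfun]]
    have [measurable]: "H \<in> borel_measurable ?M" "Z \<in> borel_measurable ?M"
      unfolding H_def Z_def lift_hamiltonian_def lift_replacement_def Let_def by measurable
    have "(\<lambda>t. replacement_blinfun (H t, Z t)) \<in> borel_measurable ?M" by measurable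
    moreover have "N \<inter> space ?M \<in> sets ?M" using N by auto
    ultimately have L: "L \<in> borel_measurable ?M"
      unfolding L_def by (intro measurable_If_set) simp_all
    have K0: "0 \<le> K" using kv by (simp add: K_def)
    obtain D where D: "\<And>(A :: 'n op) X. psd A \<Longrightarrow> A \<noteq> 0 \<Longrightarrow> norm A \<le> max 0 B \<Longrightarrow> norm X \<le> max 0 C \<Longrightarrow>
        norm (replacement_blinfun (lift_hamiltonian A X, lift_replacement K A X))
          \<le> D * inverse (spectral_gap A)"
      using norm_lift_le[of "max 0 C" K "max 0 B"] K0 by (metis max.cobounded1)
    \<comment> \<open>This is the integrable majorant of the norm of \<open>L\<close>.\<close>
    have "integrable ?M (\<lambda>t. D * inverse (spectral_gap (\<rho> t)))" using assms(9) by simp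
    moreover have "AE t in ?M. norm (L t) \<le> norm (D * inverse (spectral_gap (\<rho> t)))"
      using AE_good
    proof eventually_elim
      case (elim t)
      then have "norm (L t) \<le> D * inverse (spectral_gap (\<rho> t))"
        using good[OF elim] unfolding L_def H_def Z_def by (simp add: D psd nz)
      then show ?case by simp
    qed
    ultimately show ?thesis using L by (metis Bochner_Integration.integrable_bound)
  qed
  ultimately show ?thesis by blast
qed

end
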